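(* Let $\mathcal{D}$ be a circle and $\mathcal{P}$ a parabola in the real plane which are nowhere tangential, and suppose that $\mathcal{D}$ has a nonempty intersection with the nonconvex complement of $\mathcal{P}$. Then there exists a triangle (non-trivial or trivial) inscribed in $\mathcal{D}$ and circumscribed about $\mathcal{P}$ if and only if $\mathcal{D}$ contains the focus of $\mathcal{P}$. Moreover, in such a case, every point of $\mathcal{D}$ lying in the nonconvex complement of $\mathcal{P}$ and every point of intersection of $\mathcal{D}$ with $\mathcal{P}$ is a vertex of such a (non-trivial or trivial) triangle.
   Context: "The circle contains a point" means that the point lies on the circle (as a curve). The complement of a parabola in the plane has two connected components; the convex one contains the focus, and the other one is called the nonconvex complement; through a point of the latter pass two real tangents to the parabola. "Nowhere tangential" means that at no common point do the circle and the parabola have the same tangent line. A polygon is inscribed in $\mathcal{D}$ if its vertices lie on $\mathcal{D}$, and circumscribed about $\mathcal{P}$ if the lines containing its sides are tangent to $\mathcal{P}$. A triangle $ABC$ inscribed in $\mathcal{D}$ circumscribes $\mathcal{P}$ non-trivially if $A,B,C$ are distinct points of $\mathcal{D}$ and the lines $AB,BC,AC$ are tangent to $\mathcal{P}$. A point of a common tangent is a point $X\in\mathcal{D}$ such that the tangent line to $\mathcal{D}$ at $X$ is also tangent to $\mathcal{P}$. A trivial triangle is the degenerate one with two vertex positions: a vertex $Y\in\mathcal{D}\cap\mathcal{P}$ and a double vertex $X\in\mathcal{D}$, where $X$ is the other intersection point with $\mathcal{D}$ of the tangent to $\mathcal{P}$ at $Y$, and $X$ is a point of a common tangent of $\mathcal{D}$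 and $\mathcal{P}$. Only real polygons are considered. *)

theory Defs
  imports "HOL-Analysis.Analysis"
begin

text \<open>The circle with centre \<open>c\<close> and radius \<open>r > 0\<close> is the library's \<open>sphere c r\<close>, and the line
  through two distinct points \<open>A\<close>, \<open>B\<close> is \<open>affine hull {A, B}\<close>.\<close>

definition is_line :: "(real^2) set \<Rightarrow> bool" where
  "is_line l \<longleftrightarrow> affine l \<and> aff_dim l = 1"

text \<open>Focus \<open>F\<close> and directrix \<open>d\<close>; this is a (nondegenerate) parabola when \<open>d\<close> is a line and
  \<open>F \<notin> d\<close>.\<close>

definition parabola :: "real^2 \<Rightarrow> (real^2) set \<Rightarrow> (real^2) set" where
  "parabola F d = {X. dist X F = infdist X d}"

text \<open>The complement of a parabola has exactly two connected components, exactly one of which is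
  not convex; the union below therefore is that single component.\<close>

definition nonconvex_complement :: "(real^2) set \<Rightarrow> (real^2) set" where
  "nonconvex_complement P = \<Union>{C \<in> components (- P). \<not> convex C}"

text \<open>The line \<open>l\<close> passes through \<open>Y\<close> in the direction of a nonzero velocity vector of a path that
  runs inside the curve \<open>C\<close>. Circles and parabolas are smooth curves, so there is exactly one such
  line at each of their points.\<close>

definition tangent_line_at :: "(real^2) set \<Rightarrow> real^2 \<Rightarrow> (real^2) set \<Rightarrow> bool" where
  "tangent_line_at C Y l \<longleftrightarrow>
     (\<exists>(g :: real \<Rightarrow> real^2) v.
        g 0 = Y \<and> (\<forall>\<^sub>F t in nhds 0. g t \<in> C) \<and>
        (g has_vector_derivative v) (at 0) \<and> v \<noteq> 0 \<and>
        l = range (\<lambda>s. Y + s *\<^sub>R v))"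

definition tangent_line :: "(real^2) set \<Rightarrow> (real^2) set \<Rightarrow> bool" where
  "tangent_line C l \<longleftrightarrow> (\<exists>Y\<in>C. tangent_line_at C Y l)"

definition nowhere_tangential :: "(real^2) set \<Rightarrow> (real^2) set \<Rightarrow> bool" where
  "nowhere_tangential D P \<longleftrightarrow>
     \<not> (\<exists>Y \<in> D \<inter> P. \<exists>l. tangent_line_at D Y l \<and> tangent_line_at P Y l)"

definition nontrivial_triangle ::
    "(real^2) set \<Rightarrow> (real^2) set \<Rightarrow> real^2 \<Rightarrow> real^2 \<Rightarrow> real^2 \<Rightarrow> bool" where
  "nontrivial_triangle D P A B C \<longleftrightarrow>
     A \<in> D \<and> B \<in> D \<and> C \<in> D \<and> A \<noteq> B \<and> B \<noteq> C \<and> A \<noteq> C \<and>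
     tangent_line P (affine hull {A, B}) \<and>
     tangent_line P (affine hull {B, C}) \<and>
     tangent_line P (affine hull {A, C})"

definition common_tangent_point :: "(real^2) set \<Rightarrow> (real^2) set \<Rightarrow> real^2 \<Rightarrow> bool" where
  "common_tangent_point D P X \<longleftrightarrow>
     X \<in> D \<and> (\<exists>l. tangent_line_at D X l \<and> tangent_line P l)"

text \<open>\<open>Y\<close> is the simple vertex and \<open>X\<close> the double one.\<close>

definition trivial_triangle ::
    "(real^2) set \<Rightarrow> (real^2) set \<Rightarrow> real^2 \<Rightarrow> real^2 \<Rightarrow> bool" where
  "trivial_triangle D P Y X \<longleftrightarrow>
     Y \<in> D \<inter> P \<and> X \<in> D \<and> X \<noteq> Y \<and>
     (\<exists>l. tangent_line_at P Y l \<and> X \<in> l) \<and>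
     common_tangent_point D P X"

text \<open>\<open>V\<close> is the vertex set (of three, respectively two, points) of a non-trivial or trivial
  triangle.\<close>

definition poncelet_triangle :: "(real^2) set \<Rightarrow> (real^2) set \<Rightarrow> (real^2) set \<Rightarrow> bool" where
  "poncelet_triangle D P V \<longleftrightarrow>
     (\<exists>A B C. V = {A, B, C} \<and> nontrivial_triangle D P A B C) \<or>
     (\<exists>Y X. V = {Y, X} \<and> trivial_triangle D P Y X)"

end

theory Submission
  imports Defs
begin

text \<open>In coordinates with the vertex of the parabola at the origin and its focus at \<open>(0, 1)\<close>, the
  parabola is \<open>x\<^sup>2 = 4 y\<close>, its tangents are the lines \<open>y = t x - t\<^sup>2\<close>, and the tangents with
  parameters \<open>s\<close> and \<open>t\<close> meet at \<open>(s + t, s t)\<close>; the points of this form with real \<open>s \<noteq> t\<close> are those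
  of the nonconvex complement. The circumcircle of the triangle cut out by the tangents with
  parameters \<open>s, t, u\<close> has centre \<open>(m, n)\<close> with \<open>2 m = s + t + u - s t u\<close>,
  \<open>2 n = 1 + s t + s u + t u\<close>, and passes through the focus (Lambert). Conversely, if the circle
  contains the focus and \<open>(s + t, s t)\<close>, these two equations are linear in \<open>u\<close> and consistent, so a
  third tangent always exists. A coincidence between two of the parameters gives a trivial triangle,
  and \<open>s = t = u\<close> would make the circle tangent to the parabola.\<close>

section \<open>Vectors, tangency and the adapted coordinate frame\<close>

definition perp :: "real^2 \<Rightarrow> real^2" where
  "perp v = vector [v $ 2, - v $ 1]"

lemma perp_nth [simp]: "perp v $ 1 = v $ 2" "perp v $ 2 = - v $ 1"
  by (simp_all add: perp_def)

lemma inner_real2: "(v :: real^2) \<bullet> w = v $ 1 * w $ 1 + v $ 2 * w $ 2"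
  by (simp add: inner_vec_def sum_2)

lemma tangent_line_at_mem: "tangent_line_at C Y l \<Longrightarrow> Y \<in> C"
  by (auto simp: tangent_line_at_def dest: eventually_nhds_x_imp_x)

text \<open>The vertex is \<open>p\<close>, the focus \<open>p + e\<close>; the frame is orthogonal and scaled to make the focal
  distance 1.\<close>

locale parabola_frame =
  fixes p e :: "real^2"
  assumes e_nonzero: "e \<noteq> 0"
begin

text \<open>\<open>xd\<close> and \<open>yd\<close> are linear and measure directions;
  \<open>xc\<close> and \<open>yc\<close> measure points relative to the vertex. Both kinds are
  needed because velocities of paths are directions.\<close>

definition xd :: "real^2 \<Rightarrow> real" where "xd v = v \<bullet> perp e / (e \<bullet> e)"
definition yd :: "real^2 \<Rightarrow> real" where "yd v = v \<bullet> e / (e \<bullet> e)"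
definition xc :: "real^2 \<Rightarrow> real" where "xc X = xd (X - p)"
definition yc :: "real^2 \<Rightarrow> real" where "yc X = yd (X - p)"
definition pt :: "real \<Rightarrow> real \<Rightarrow> real^2" where
  "pt x y = p + x *\<^sub>R perp e + y *\<^sub>R e"

lemma ee_pos: "e \<bullet> e > 0"
  using e_nonzero by simp

lemma ee_components: "e $ 1 * e $ 1 + e $ 2 * e $ 2 \<noteq> 0"
  using ee_pos unfolding inner_real2 by linarith

lemma bounded_linear_xd: "bounded_linear xd" and bounded_linear_yd: "bounded_linear yd"
  unfolding xd_def yd_def
  by (intro bounded_linear_compose[OF bounded_linear_divide] bounded_linear_inner_left)+

lemma xd_simps [simp]: "xd (v + w) = xd v + xd w" "xd (v - w) = xd v - xd w" "xd (s *\<^sub>R v) = s * xd v"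
  and yd_simps [simp]: "yd (v + w) = yd v + yd w" "yd (v - w) = yd v - yd w" "yd (s *\<^sub>R v) = s * yd v"
  by (simp_all add: xd_def yd_def inner_add_left inner_diff_left add_divide_distrib diff_divide_distrib)

lemma frame_decomp: "v = xd v *\<^sub>R perp e + yd v *\<^sub>R e"
proof -
  have "(e \<bullet> e) *\<^sub>R v = (v \<bullet> perp e) *\<^sub>R perp e + (v \<bullet> e) *\<^sub>R e"
    by (simp add: vec_eq_iff forall_2 inner_real2 algebra_simps)
  then have "v = (1 / (e \<bullet> e)) *\<^sub>R ((v \<bullet> perp e) *\<^sub>R perp e + (v \<bullet> e) *\<^sub>R e)"
    using ee_pos by (metis divideR_right inverse_eq_divide less_irrefl)
  then show ?thesis
    by (simp add: xd_def yd_def scaleR_add_right)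
qed

lemma pt_xc_yc [simp]: "pt (xc X) (yc X) = X"
  using frame_decomp[of "X - p"] by (simp add: pt_def xc_def yc_def algebra_simps)

lemma frame_basis [simp]: "xd (perp e) = 1" "yd (perp e) = 0" "xd e = 0" "yd e = 1"
  using ee_components by (simp_all add: xd_def yd_def inner_real2 field_simps)

lemma xc_pt [simp]: "xc (pt x y) = x" and yc_pt [simp]: "yc (pt x y) = y"
  by (simp_all add: xc_def yc_def pt_def flip: xd_simps yd_simps) (simp_all)

lemma coords_add_scaled [simp]: "xc (X + s *\<^sub>R v) = xc X + s * xd v" "yc (X + s *\<^sub>R v) = yc X + s * yd v"
  by (simp_all add: xc_def yc_def)

lemma point_eq_iff: "X = Y \<longleftrightarrow> xc X = xc Y \<and> yc X = yc Y"
  by (metis pt_xc_yc)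

lemma frame_eq_zero: "v = 0" if "xd v = 0" "yd v = 0"
  using frame_decomp[of v] that by simp

text \<open>\<open>perp e\<close> and \<open>e\<close> are orthogonal of equal length, so the frame
  only rescales distances and circles stay circles.\<close>

lemma dist_sq: "(dist X Y)\<^sup>2 = (e \<bullet> e) * ((xc X - xc Y)\<^sup>2 + (yc X - yc Y)\<^sup>2)"
proof -
  define v where "v = X - Y"
  have "(dist X Y)\<^sup>2 = v \<bullet> v" by (simp add: dist_norm power2_norm_eq_inner v_def)
  also have "\<dots> = (xd v *\<^sub>R perp e + yd v *\<^sub>R e) \<bullet> (xd v *\<^sub>R perp e + yd v *\<^sub>R e)"
    using frame_decomp[of v] by simp
  also have "\<dots> = (e \<bullet> e) * ((xd v)\<^sup>2 + (yd v)\<^sup>2)"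
    by (simp add: inner_real2 power2_eq_square algebra_simps)
  finally show ?thesis by (simp add: v_def xc_def yc_def)
qed

section \<open>Tangent lines of the parabola and of circles\<close>

definition tline :: "real \<Rightarrow> (real^2) set" where
  "tline t = {X. yc X = t * xc X - t\<^sup>2}"

abbreviation par :: "(real^2) set" where "par \<equiv> {X. (xc X)\<^sup>2 = 4 * yc X}"

text \<open>In the plane, the vectors orthogonal to a nonzero normal \<open>(a, b)\<close> are
  exactly the multiples of any nonzero one of them. This turns the parametrised lines of
  \<open>tangent_line_at\<close> into equations.\<close>

lemma line_eq_level_set: "range (\<lambda>s. Y + s *\<^sub>R v) = {X. a * (xc X - xc Y) + b * (yc X - yc Y) = 0}"
  if ab: "a \<noteq> 0 \<or> b \<noteq> 0" and v: "v \<noteq> 0" and n: "a * xd v + b * yd v = 0"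
proof (rule set_eqI, rule iffI)
  fix X assume "X \<in> range (\<lambda>s. Y + s *\<^sub>R v)"
  then obtain s where "X = Y + s *\<^sub>R v" by auto
  then have "a * (xc X - xc Y) + b * (yc X - yc Y) = s * (a * xd v + b * yd v)"
    by (simp add: algebra_simps)
  then show "X \<in> {X. a * (xc X - xc Y) + b * (yc X - yc Y) = 0}" using n by simp
next
  fix X assume "X \<in> {X. a * (xc X - xc Y) + b * (yc X - yc Y) = 0}"
  then have 1: "a * (xc X - xc Y) + b * (yc X - yc Y) = 0" by simp
  define N where "N = (xd v)\<^sup>2 + (yd v)\<^sup>2"
  have N: "N \<noteq> 0" using frame_eq_zero v by (auto simp: N_def sum_power2_eq_zero_iff)
  \<comment> \<open>The parameter of the orthogonal projection of \<open>X - Y\<close> onto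
    \<open>v\<close>; by \<open>c\<close> below the two vectors are parallel, so nothing is
    lost.\<close>
  define s where "s = ((xc X - xc Y) * xd v + (yc X - yc Y) * yd v) / N"
  have c: "(xc X - xc Y) * yd v = (yc X - yc Y) * xd v"
    using ab
  proof
    assume "a \<noteq> 0"
    have "a * ((xc X - xc Y) * yd v - (yc X - yc Y) * xd v) = 0"
      using 1 n by algebra
    then show ?thesis using \<open>a \<noteq> 0\<close> by simp
  next
    assume "b \<noteq> 0"
    have "b * ((xc X - xc Y) * yd v - (yc X - yc Y) * xd v) = 0"
      using 1 n by algebra
    then show ?thesis using \<open>b \<noteq> 0\<close> by simp
  qed
  have sN: "s * N = (xc X - xc Y) * xd v + (yc X - yc Y) * yd v" using N by (simp add: s_def)
  have "N * (xc X - xc Y - s * xd v) = 0" "N * (yc X - yc Y - s * yd v) = 0"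
    using sN c unfolding N_def by algebra+
  then have "X = Y + s *\<^sub>R v" using N by (auto simp: point_eq_iff)
  then show "X \<in> range (\<lambda>s. Y + s *\<^sub>R v)" by auto
qed

text \<open>The defining polynomial vanishes along any path inside the conic, so by the chain rule
  its gradient at \<open>Y\<close> is orthogonal to the velocity. One computation serves parabola
  and circle.\<close>

lemma tangent_line_at_conic:
  fixes \<alpha> \<beta> \<gamma> \<delta> \<epsilon> :: real
  assumes l: "tangent_line_at {X. \<alpha> * (xc X)\<^sup>2 + \<beta> * (yc X)\<^sup>2 + \<gamma> * xc X + \<delta> * yc X + \<epsilon> = 0} Y l"
    and ab: "2 * \<alpha> * xc Y + \<gamma> \<noteq> 0 \<or> 2 * \<beta> * yc Y + \<delta> \<noteq> 0"
  shows "l = {X. (2 * \<alpha> * xc Y + \<gamma>) * (xc X - xc Y) + (2 * \<beta> * yc Y + \<delta>) * (yc X - yc Y) = 0}"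
proof -
  from l obtain g v where g0: "g 0 = Y"
    and ev: "\<forall>\<^sub>F t in nhds (0::real). \<alpha> * (xc (g t))\<^sup>2 + \<beta> * (yc (g t))\<^sup>2 + \<gamma> * xc (g t) + \<delta> * yc (g t) + \<epsilon> = 0"
    and dg: "(g has_vector_derivative v) (at 0)" and v: "v \<noteq> 0" and l: "l = range (\<lambda>s. Y + s *\<^sub>R v)"
    unfolding tangent_line_at_def by auto
  have "((\<lambda>t. g t - p) has_vector_derivative v) (at 0)"
    using dg by (auto intro!: derivative_eq_intros)
  from bounded_linear.has_vector_derivative[OF bounded_linear_xd this] bounded_linear.has_vector_derivative[OF bounded_linear_yd this]
  have dx [derivative_intros]: "((\<lambda>t. xc (g t)) has_real_derivative xd v) (at 0)"
    and dy [derivative_intros]: "((\<lambda>t. yc (g t)) has_real_derivative yd v) (at 0)"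
    by (simp_all add: has_real_derivative_iff_has_vector_derivative xc_def yc_def)
  let ?f = "\<lambda>t. \<alpha> * (xc (g t))\<^sup>2 + \<beta> * (yc (g t))\<^sup>2 + \<gamma> * xc (g t) + \<delta> * yc (g t) + \<epsilon>"
  have "(?f has_real_derivative (2 * \<alpha> * xc Y + \<gamma>) * xd v + (2 * \<beta> * yc Y + \<delta>) * yd v) (at 0)"
    by (auto intro!: derivative_eq_intros simp: g0 algebra_simps)
  moreover have "(?f has_real_derivative 0) (at 0)"
    using DERIV_cong_ev[OF refl ev refl, of 0] by simp
  ultimately have "(2 * \<alpha> * xc Y + \<gamma>) * xd v + (2 * \<beta> * yc Y + \<delta>) * yd v = 0"
    by (rule DERIV_unique)
  from line_eq_level_set[OF ab v this] l show ?thesis by simp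
qed

lemma tangent_line_at_par: "tangent_line_at par Y l \<longleftrightarrow> (\<exists>t. Y = pt (2 * t) (t\<^sup>2) \<and> l = tline t)"
proof
  assume l: "tangent_line_at par Y l"
  then have Y: "Y \<in> par" by (rule tangent_line_at_mem)
  define t where "t = xc Y / 2"
  have x: "xc Y = 2 * t" by (simp add: t_def)
  then have y: "yc Y = t\<^sup>2" using Y by (simp add: power_mult_distrib)
  have "par = {X. 1 * (xc X)\<^sup>2 + 0 * (yc X)\<^sup>2 + 0 * xc X + (-4) * yc X + 0 = 0}" by auto
  from tangent_line_at_conic[OF l[unfolded this]]
  have "l = {X. 2 * xc Y * (xc X - xc Y) = 4 * (yc X - yc Y)}" by (auto simp: algebra_simps)
  also have "\<dots> = tline t" by (auto simp: tline_def x y algebra_simps power2_eq_square)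
  finally show "\<exists>t. Y = pt (2 * t) (t\<^sup>2) \<and> l = tline t" using x y by (auto simp: point_eq_iff)
next
  assume "\<exists>t. Y = pt (2 * t) (t\<^sup>2) \<and> l = tline t"
  then obtain t where t: "Y = pt (2 * t) (t\<^sup>2)" "l = tline t" by auto
  \<comment> \<open>The standard parametrisation of the parabola, shifted to pass through
    \<open>Y\<close> at time 0.\<close>
  let ?g = "\<lambda>s. pt (2 * (t + s)) ((t + s)\<^sup>2)"
  let ?v = "2 *\<^sub>R perp e + (2 * t) *\<^sub>R e"
  have v: "xd ?v = 2" "yd ?v = 2 * t" by simp_all
  have v0: "?v \<noteq> 0" using v(1) by (metis scaleR_zero_left xd_simps(3) mult_zero_left zero_neq_numeral)
  have "(?g has_vector_derivative ?v) (at 0)"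
    unfolding pt_def by (auto intro!: derivative_eq_intros simp: algebra_simps)
  moreover have "range (\<lambda>s. Y + s *\<^sub>R ?v) = l"
    using line_eq_level_set[of "-t" 1 ?v Y] v v0 by (auto simp: t tline_def algebra_simps power2_eq_square)
  moreover have "\<forall>s. ?g s \<in> par" by (simp add: power2_eq_square algebra_simps)
  ultimately show "tangent_line_at par Y l"
    unfolding tangent_line_at_def using v0 t(1)
    by (intro exI[of _ ?g] exI[of _ ?v]) (auto intro!: always_eventually)
qed

lemma tangent_line_par: "tangent_line par l \<longleftrightarrow> (\<exists>t. l = tline t)"
proof
  assume "\<exists>t. l = tline t"
  then obtain t where "l = tline t" ..
  then show "tangent_line par l"
    unfolding tangent_line_def tangent_line_at_par by (intro bexI[of _ "pt (2 * t) (t\<^sup>2)"]) auto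
qed (auto simp: tangent_line_def tangent_line_at_par)

abbreviation circ :: "real \<Rightarrow> real \<Rightarrow> real \<Rightarrow> (real^2) set" where
  "circ m n \<rho> \<equiv> {X. (xc X - m)\<^sup>2 + (yc X - n)\<^sup>2 = \<rho>}"

lemma tangent_line_at_circ:
  assumes "\<rho> > 0"
  shows "tangent_line_at (circ m n \<rho>) Y l \<longleftrightarrow>
    Y \<in> circ m n \<rho> \<and> l = {X. (xc Y - m) * (xc X - xc Y) + (yc Y - n) * (yc X - yc Y) = 0}"
proof
  assume l: "tangent_line_at (circ m n \<rho>) Y l"
  then have Y: "Y \<in> circ m n \<rho>" by (rule tangent_line_at_mem)
  then have ne: "xc Y - m \<noteq> 0 \<or> yc Y - n \<noteq> 0" using assms by auto
  have "circ m n \<rho> = {X. 1 * (xc X)\<^sup>2 + 1 * (yc X)\<^sup>2 + (-2*m) * xc X + (-2*n) * yc X + (m\<^sup>2 + n\<^sup>2 - \<rho>) = 0}"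
    by (auto simp: power2_eq_square algebra_simps)
  from tangent_line_at_conic[OF l[unfolded this]] ne
  have "l = {X. (2 * xc Y - 2 * m) * (xc X - xc Y) + (2 * yc Y - 2 * n) * (yc X - yc Y) = 0}" by simp
  also have "\<dots> = {X. (xc Y - m) * (xc X - xc Y) + (yc Y - n) * (yc X - yc Y) = 0}"
    by (auto simp: algebra_simps)
  finally show "Y \<in> circ m n \<rho> \<and> l = {X. (xc Y - m) * (xc X - xc Y) + (yc Y - n) * (yc X - yc Y) = 0}"
    using Y by auto
next
  assume A: "Y \<in> circ m n \<rho> \<and> l = {X. (xc Y - m) * (xc X - xc Y) + (yc Y - n) * (yc X - yc Y) = 0}"
  define a where "a = xc Y - m"
  define b where "b = yc Y - n"
  have ne: "a \<noteq> 0 \<or> b \<noteq> 0" and ab: "a\<^sup>2 + b\<^sup>2 = \<rho>" using A assms by (auto simp: a_def b_def)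
  \<comment> \<open>\<open>Y\<close> rotated about the centre by the angle \<open>s\<close>; its
    initial velocity is the radius vector turned by a right angle.\<close>
  let ?g = "\<lambda>s. pt (m + cos s * a - sin s * b) (n + cos s * b + sin s * a)"
  let ?v = "(-b) *\<^sub>R perp e + a *\<^sub>R e"
  have v: "xd ?v = -b" "yd ?v = a" by (simp_all del: scaleR_minus_left)
  have v0: "?v \<noteq> 0" using v ne by (metis scaleR_zero_left xd_simps(3) yd_simps(3) mult_zero_left neg_equal_0_iff_equal)
  have "(?g has_vector_derivative ?v) (at 0)"
    unfolding pt_def by (auto intro!: derivative_eq_intros simp: algebra_simps)
  moreover have "range (\<lambda>s. Y + s *\<^sub>R ?v) = l"
  proof -
    have "a * xd ?v + b * yd ?v = 0" unfolding v by simp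
    from line_eq_level_set[OF ne v0 this, of Y] show ?thesis using A by (simp only: a_def b_def)
  qed
  moreover have "\<forall>s. ?g s \<in> circ m n \<rho>"
  proof
    fix s :: real
    have "(cos s * a - sin s * b)\<^sup>2 + (cos s * b + sin s * a)\<^sup>2 = ((cos s)\<^sup>2 + (sin s)\<^sup>2) * (a\<^sup>2 + b\<^sup>2)" by algebra
    then show "?g s \<in> circ m n \<rho>" using ab by (simp add: algebra_simps)
  qed
  moreover have "?g 0 = Y" by (simp add: a_def b_def)
  ultimately show "tangent_line_at (circ m n \<rho>) Y l"
    unfolding tangent_line_at_def using v0
    by (intro exI[of _ ?g] exI[of _ ?v]) (auto intro!: always_eventually)
qed

section \<open>Incidence of points with tangents of the parabola\<close>

lemma affine_hull_tline:
  assumes "A \<in> tline t" "B \<in> tline t" "A \<noteq> B"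
  shows "affine hull {A, B} = tline t"
proof -
  have AB: "yc A = t * xc A - t\<^sup>2" "yc B = t * xc B - t\<^sup>2" using assms by (auto simp: tline_def)
  have "affine hull {A, B} = range (\<lambda>s. A + s *\<^sub>R (B - A))"
    by (auto simp: affine_hull_2_alt)
  also have "\<dots> = {X. (-t) * (xc X - xc A) + 1 * (yc X - yc A) = 0}"
  proof (rule line_eq_level_set)
    have "xd (B - A) = xc B - xc A" "yd (B - A) = yc B - yc A" by (simp_all add: xc_def yc_def)
    then show "- t * xd (B - A) + 1 * yd (B - A) = 0" using AB by algebra
  qed (use assms in auto)
  also have "\<dots> = tline t" using AB by (auto simp: tline_def algebra_simps)
  finally show ?thesis .
qed

lemma tline_inter: "X \<in> tline s \<inter> tline t \<longleftrightarrow> X = pt (s + t) (s * t)" if "s \<noteq> t"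
proof
  assume "X \<in> tline s \<inter> tline t"
  then have *: "yc X = s * xc X - s\<^sup>2" "yc X = t * xc X - t\<^sup>2" by (auto simp: tline_def)
  then have "(s - t) * (xc X - (s + t)) = 0" by algebra
  then have x: "xc X = s + t" using that by simp
  then show "X = pt (s + t) (s * t)" using * by (simp add: point_eq_iff power2_eq_square algebra_simps)
qed (auto simp: tline_def power2_eq_square algebra_simps)

lemma pt_in_tline [simp]: "pt (s + t) (s * t) \<in> tline s" "pt (s + t) (s * t) \<in> tline t"
  by (auto simp: tline_def power2_eq_square algebra_simps)


lemma tline_point:
  assumes "X \<in> tline t" obtains s where "X = pt (t + s) (t * s)"
  using assms by (intro that[of "xc X - t"]) (simp add: tline_def point_eq_iff power2_eq_square algebra_simps)

section \<open>The two sides of the parabola\<close>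

lemma continuous_xc: "continuous_on S xc" and continuous_yc: "continuous_on S yc"
  unfolding xc_def yc_def
  by (intro bounded_linear.continuous_on[OF bounded_linear_xd] bounded_linear.continuous_on[OF bounded_linear_yd] continuous_intros)+

lemma coords_convex_combination:
  assumes "u + v = 1"
  shows "xc (u *\<^sub>R A + v *\<^sub>R B) = u * xc A + v * xc B" "yc (u *\<^sub>R A + v *\<^sub>R B) = u * yc A + v * yc B"
proof -
  have u: "u = 1 - v" using assms by simp
  have "u *\<^sub>R A + v *\<^sub>R B = A + v *\<^sub>R (B - A)" by (simp add: u algebra_simps)
  then show "xc (u *\<^sub>R A + v *\<^sub>R B) = u * xc A + v * xc B" "yc (u *\<^sub>R A + v *\<^sub>R B) = u * yc A + v * yc B"
    by (simp_all only: coords_add_scaled xc_def yc_def xd_simps yd_simps) (simp_all add: u algebra_simps)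
qed

lemma convex_interior: "convex {X. (xc X)\<^sup>2 < 4 * yc X}"
proof (rule convexI)
  fix A B :: "real^2" and u v :: real
  assume *: "A \<in> {X. (xc X)\<^sup>2 < 4 * yc X}" "B \<in> {X. (xc X)\<^sup>2 < 4 * yc X}" "0 \<le> u" "0 \<le> v" "u + v = 1"
  have u: "u = 1 - v" using * by simp
  have "(u * xc A + v * xc B)\<^sup>2 = u * (xc A)\<^sup>2 + v * (xc B)\<^sup>2 - u * v * (xc A - xc B)\<^sup>2"
    unfolding u by algebra
  also have "\<dots> \<le> u * (xc A)\<^sup>2 + v * (xc B)\<^sup>2" using * by simp
  also have "\<dots> < u * (4 * yc A) + v * (4 * yc B)"
  \<comment> \<open>Strictness must come from a point of positive weight: \<open>B\<close> if
    \<open>u = 0\<close>, otherwise \<open>A\<close>.\<close>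
  proof (cases "u = 0")
    case True
    then show ?thesis using * by simp
  next
    case False
    then show ?thesis using * by (intro add_less_le_mono mult_strict_left_mono mult_left_mono) auto
  qed
  finally show "u *\<^sub>R A + v *\<^sub>R B \<in> {X. (xc X)\<^sup>2 < 4 * yc X}"
    unfolding mem_Collect_eq coords_convex_combination[OF \<open>u + v = 1\<close>] by (simp add: algebra_simps)
qed

text \<open>A component meeting the convex side cannot cross to the other open side, and by
  maximality it contains the whole convex side. It would then equal that side and be convex.\<close>

lemma nonconvex_complement_par:
  assumes "X \<in> nonconvex_complement par"
  shows "(xc X)\<^sup>2 > 4 * yc X"
proof (rule ccontr)
  assume "\<not> (xc X)\<^sup>2 > 4 * yc X"
  from assms obtain C where C: "C \<in> components (- par)" "\<not> convex C" "X \<in> C"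
    by (auto simp: nonconvex_complement_def)
  let ?I = "{X. (xc X)\<^sup>2 < 4 * yc X}" and ?E = "{X. (xc X)\<^sup>2 > 4 * yc X}"
  have "C \<subseteq> - par" using C(1) by (rule in_components_subset)
  then have sub: "C \<subseteq> ?I \<union> ?E" and X: "X \<in> ?I"
    using C(3) \<open>\<not> (xc X)\<^sup>2 > 4 * yc X\<close> by force+
  have "open ?I" "open ?E"
    by (intro open_Collect_less continuous_intros continuous_xc continuous_yc)+
  moreover have "connected C" using C(1) by (rule in_components_connected)
  ultimately have "?I \<inter> C = {} \<or> ?E \<inter> C = {}"
    using sub by (intro connectedD) auto
  then have "C \<subseteq> ?I" using X C(3) sub by auto
  moreover have "?I \<subseteq> C"
    using X C(3) by (intro components_maximal[OF C(1) convex_connected[OF convex_interior]]) auto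
  ultimately show False using C(2) convex_interior by (metis subset_antisym)
qed

section \<open>The given parabola and circle in coordinates\<close>

lemma parabola_eq_par: "parabola (pt 0 1) {X. yc X = -1} = par"
proof -
  have "infdist X {X. yc X = -1} = dist X (pt (xc X) (-1))" for X
  proof (rule antisym)
    show "infdist X {X. yc X = -1} \<le> dist X (pt (xc X) (-1))" by (rule infdist_le) simp
    have "dist X (pt (xc X) (-1)) \<le> dist X Y" if "yc Y = -1" for Y
    proof (rule power2_le_imp_le)
      show "(dist X (pt (xc X) (-1)))\<^sup>2 \<le> (dist X Y)\<^sup>2"
        unfolding dist_sq using that ee_pos by (intro mult_left_mono) auto
    qed simp
    \<comment> \<open>A nonempty directrix makes \<open>infdist\<close> a genuine infimum rather
      than its default value 0.\<close>
    moreover have "pt 0 (-1) \<in> {X. yc X = -1}" by simp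
    ultimately show "dist X (pt (xc X) (-1)) \<le> infdist X {X. yc X = -1}"
      by (subst infdist_notempty) (blast, intro cINF_greatest, blast, simp)
  qed
  then have "parabola (pt 0 1) {X. yc X = -1} = {X. (dist X (pt 0 1))\<^sup>2 = (dist X (pt (xc X) (-1)))\<^sup>2}"
    by (simp add: parabola_def)
  also have "\<dots> = {X. (xc X)\<^sup>2 + (yc X - 1)\<^sup>2 = (yc X + 1)\<^sup>2}" using ee_pos by (simp add: dist_sq)
  also have "\<dots> = par" by (auto simp: power2_eq_square algebra_simps)
  finally show ?thesis .
qed

lemma sphere_eq_circ: "sphere c r = circ (xc c) (yc c) (r\<^sup>2 / (e \<bullet> e))" if "r > 0"
proof -
  have "X \<in> sphere c r \<longleftrightarrow> X \<in> circ (xc c) (yc c) (r\<^sup>2 / (e \<bullet> e))" for X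
  proof -
    have "X \<in> sphere c r \<longleftrightarrow> (dist X c)\<^sup>2 = r\<^sup>2"
      using that by (simp add: dist_commute)
    also have "\<dots> \<longleftrightarrow> X \<in> circ (xc c) (yc c) (r\<^sup>2 / (e \<bullet> e))"
      unfolding dist_sq mem_Collect_eq using ee_pos by (subst eq_divide_eq) (simp add: mult.commute)
    finally show ?thesis .
  qed
  then show ?thesis by blast
qed

section \<open>From the focus to a triangle\<close>

text \<open>The circle with centre \<open>(m, n)\<close> through the focus is the circumcircle of the triangle formed
  by the tangents with parameters \<open>s\<close>, \<open>t\<close>, \<open>u\<close>.\<close>

definition tangent_triple :: "real \<Rightarrow> real \<Rightarrow> real \<Rightarrow> real \<Rightarrow> real \<Rightarrow> bool" where
  "tangent_triple m n s t u \<longleftrightarrow> s + t + u - s * t * u = 2 * m \<and> 1 + s * t + s * u + t * u = 2 * n"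

lemma tangent_triple_exists:
  assumes "pt 0 1 \<in> circ m n \<rho>" "pt (s + t) (s * t) \<in> circ m n \<rho>"
  obtains u where "tangent_triple m n s t u"
proof -
  define N where "N = (1 + s\<^sup>2) * (1 + t\<^sup>2)"
  have "1 + s\<^sup>2 > 0" "1 + t\<^sup>2 > 0" by (simp_all add: add_pos_nonneg)
  then have N: "N \<noteq> 0" unfolding N_def by auto
  \<comment> \<open>With \<open>\<sigma> = s + t\<close> and \<open>\<pi> = s t\<close> the two equations are \<open>u \<sigma> = 2 n - 1 - \<pi>\<close> and \<open>u (1 - \<pi>) = 2 m - \<sigma>\<close>,
    and \<open>\<sigma>\<^sup>2 + (1 - \<pi>)\<^sup>2 = N\<close>.\<close>
  define u where "u = ((2*n - 1 - s*t) * (s + t) + (2*m - s - t) * (1 - s*t)) / N"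
  have u: "u * N = (2*n - 1 - s*t) * (s + t) + (2*m - s - t) * (1 - s*t)" using N by (simp add: u_def)
  \<comment> \<open>Equal distances of vertex and focus from the centre: this is exactly the
    consistency condition of the two linear equations.\<close>
  have q: "(s + t - m)\<^sup>2 + (s * t - n)\<^sup>2 = m\<^sup>2 + (1 - n)\<^sup>2"
    using assms by simp
  have "N * (s + t + u - s * t * u - 2 * m) = 0" "N * (1 + s * t + s * u + t * u - 2 * n) = 0"
    using u q unfolding N_def by algebra+
  then show ?thesis using N by (intro that[of u]) (auto simp: tangent_triple_def)
qed

text \<open>Lambert's theorem: the defining equations make the vertex and the focus equidistant from
  the centre. The symmetry of the triple then handles the other two vertices.\<close>

lemma tangent_triple_circ:
  assumes "pt 0 1 \<in> circ m n \<rho>" "tangent_triple m n s t u"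
  shows "pt (s + t) (s * t) \<in> circ m n \<rho>"
proof -
  have *: "m\<^sup>2 + (1 - n)\<^sup>2 = \<rho>" "s + t + u - s * t * u = 2 * m" "1 + s * t + s * u + t * u = 2 * n"
    using assms by (simp_all add: tangent_triple_def)
  have "(s + t - m)\<^sup>2 + (s * t - n)\<^sup>2 - (m\<^sup>2 + (1 - n)\<^sup>2) = (s + t) * (s + t - 2 * m) + s * t * (s * t - 2 * n) + 2 * n - 1" by algebra
  also have "\<dots> = 0" unfolding *(2,3)[symmetric] by algebra
  finally show ?thesis using * by simp
qed

lemma tangent_triple_commute:
  "tangent_triple m n s t u \<Longrightarrow> tangent_triple m n t s u"
  "tangent_triple m n s t u \<Longrightarrow> tangent_triple m n s u t"
  by (auto simp: tangent_triple_def algebra_simps)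

text \<open>The side on tangent \<open>t\<close> has its ends on tangents \<open>s\<close> and
  \<open>u\<close>; when \<open>u = s\<close> the ends merge and the chord becomes a tangent of the
  circle. The case \<open>s = t\<close> is included, to be refuted by
  \<open>nowhere_tangential\<close>.\<close>

lemma tline_tangent_circ:
  assumes \<rho>: "\<rho> > 0" and F: "pt 0 1 \<in> circ m n \<rho>" and tr: "tangent_triple m n s s t"
  shows "tangent_line_at (circ m n \<rho>) (pt (s + t) (s * t)) (tline t)"
proof -
  have *: "s + s + t - s * s * t = 2 * m" "1 + s * s + s * t + s * t = 2 * n"
    using tr by (simp_all add: tangent_triple_def)
  let ?X = "pt (s + t) (s * t)"
  have X: "?X \<in> circ m n \<rho>" by (rule tangent_triple_circ[OF F tangent_triple_commute(2)[OF tr]])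
  \<comment> \<open>The radius to \<open>?X\<close> is orthogonal to the direction
    \<open>(1, t)\<close> of \<open>tline t\<close>.\<close>
  have g: "(s + t - m) + t * (s * t - n) = 0" using * by algebra
  have ne: "s * t - n \<noteq> 0" using g X \<rho> by auto
  have eq: "(s + t - m) * (x - (s + t)) + (s * t - n) * (y - s * t) = (s * t - n) * (y - (t * x - t\<^sup>2))" for x y
    using g by algebra
  have "tline t = {X. (xc ?X - m) * (xc X - xc ?X) + (yc ?X - n) * (yc X - yc ?X) = 0}"
    using ne by (auto simp: eq tline_def)
  then show ?thesis using X by (simp add: tangent_line_at_circ[OF \<rho>])
qed

text \<open>The repeated tangent meets itself in its contact point, the simple vertex; its meeting
  point with the other tangent is the double vertex.\<close>

lemma tangent_triple_trivial:
  assumes \<rho>: "\<rho> > 0" and F: "pt 0 1 \<in> circ m n \<rho>" and tr: "tangent_triple m n s s t" and st: "s \<noteq> t"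
  shows "trivial_triangle (circ m n \<rho>) par (pt (s + s) (s * s)) (pt (s + t) (s * t))"
proof -
  have "pt (s + s) (s * s) \<in> circ m n \<rho>" "pt (s + t) (s * t) \<in> circ m n \<rho>"
    using tangent_triple_circ[OF F] tr tangent_triple_commute(2) by blast+
  moreover have "tangent_line_at par (pt (s + s) (s * s)) (tline s)"
    unfolding tangent_line_at_par by (intro exI[of _ s]) (simp add: power2_eq_square)
  moreover have "pt (s + t) (s * t) \<noteq> pt (s + s) (s * s)" using st by (simp add: point_eq_iff)
  moreover have "tangent_line par (tline t)" by (auto simp: tangent_line_par)
  ultimately show ?thesis
    unfolding trivial_triangle_def common_tangent_point_def
    using tline_tangent_circ[OF \<rho> F tr] pt_in_tline(1)[of s t]
    by (auto simp: power2_eq_square)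
qed

lemma poncelet_triangle_through:
  assumes \<rho>: "\<rho> > 0" and F: "pt 0 1 \<in> circ m n \<rho>"
    and nt: "nowhere_tangential (circ m n \<rho>) par"
    and X: "pt (s + t) (s * t) \<in> circ m n \<rho>"
  shows "\<exists>V. poncelet_triangle (circ m n \<rho>) par V \<and> pt (s + t) (s * t) \<in> V"
proof -
  obtain u where tr: "tangent_triple m n s t u" using tangent_triple_exists[OF F X] .
  \<comment> \<open>Both vertices are recorded because the given point is the simple vertex if
    \<open>s = t\<close> and the double one if \<open>u\<close> equals \<open>s\<close> or
    \<open>t\<close>.\<close>
  have triv: "\<exists>V. poncelet_triangle (circ m n \<rho>) par V \<and> pt (a + a) (a * a) \<in> V \<and> pt (a + b) (a * b) \<in> V"
    if "tangent_triple m n a a b" "a \<noteq> b" for a b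
    using tangent_triple_trivial[OF \<rho> F that] unfolding poncelet_triangle_def by blast
  consider "s = t" "t = u" | "s = t" "t \<noteq> u" | "s = u" "s \<noteq> t" | "t = u" "s \<noteq> t" | "s \<noteq> t" "s \<noteq> u" "t \<noteq> u" by blast
  then show ?thesis
  proof cases
    case 1
    then have "tangent_triple m n s s s" using tr by simp
    from tline_tangent_circ[OF \<rho> F this]
    have "tangent_line_at (circ m n \<rho>) (pt (s + s) (s * s)) (tline s)" .
    moreover have "tangent_line_at par (pt (s + s) (s * s)) (tline s)"
      unfolding tangent_line_at_par by (intro exI[of _ s]) (simp add: power2_eq_square)
    ultimately show ?thesis using nt tangent_line_at_mem unfolding nowhere_tangential_def by blast
  next
    case 2
    then show ?thesis using triv[of s u] tr by auto
  next
    case 3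
    then show ?thesis using triv[of s t] tangent_triple_commute(2)[OF tr] by auto
  next
    case 4
    have "tangent_triple m n t t s" using tr 4 by (simp add: tangent_triple_def algebra_simps)
    then show ?thesis using triv[of t s] 4 by (auto simp: add.commute mult.commute)
  next
    case 5
    let ?A = "pt (s + t) (s * t)" and ?B = "pt (s + u) (s * u)" and ?C = "pt (t + u) (t * u)"
    have mem: "?B \<in> circ m n \<rho>" "?C \<in> circ m n \<rho>"
      using tangent_triple_circ[OF F] tr tangent_triple_commute by blast+
    have ne: "?A \<noteq> ?B" "?B \<noteq> ?C" "?A \<noteq> ?C" using 5 by (simp_all add: point_eq_iff)
    have "affine hull {?A, ?B} = tline s" "affine hull {?B, ?C} = tline u" "affine hull {?A, ?C} = tline t"
      using ne by (intro affine_hull_tline; simp)+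
    then have "nontrivial_triangle (circ m n \<rho>) par ?A ?B ?C"
      unfolding nontrivial_triangle_def tangent_line_par using X mem ne by blast
    then show ?thesis unfolding poncelet_triangle_def by blast
  qed
qed

section \<open>From a triangle to the focus\<close>

lemma tline_circ_at_most_two:
  assumes "A \<in> tline t" "B \<in> tline t" "C \<in> tline t"
    and "A \<in> circ m n \<rho>" "B \<in> circ m n \<rho>" "C \<in> circ m n \<rho>"
    and "A \<noteq> B" "B \<noteq> C" "A \<noteq> C"
  shows False
proof -
  have *: "yc A = t * xc A - t\<^sup>2" "yc B = t * xc B - t\<^sup>2" "yc C = t * xc C - t\<^sup>2"
    using assms by (auto simp: tline_def)
  have ne: "xc A - xc B \<noteq> 0" "xc B - xc C \<noteq> 0" "xc A - xc C \<noteq> 0"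
    using assms * by (auto simp: point_eq_iff)
  have q: "(xc A - m)\<^sup>2 + (yc A - n)\<^sup>2 = \<rho>" "(xc B - m)\<^sup>2 + (yc B - n)\<^sup>2 = \<rho>" "(xc C - m)\<^sup>2 + (yc C - n)\<^sup>2 = \<rho>"
    using assms by auto
  \<comment> \<open>The linear coefficient of the circle equation restricted to
    \<open>tline t\<close>, a quadratic in the abscissa with leading coefficient
    \<open>1 + t\<^sup>2\<close>.\<close>
  define k where "k = - 2 * m - 2 * t * (t\<^sup>2 + n)"
  have diff: "(x - m)\<^sup>2 + (t * x - t\<^sup>2 - n)\<^sup>2 - ((y - m)\<^sup>2 + (t * y - t\<^sup>2 - n)\<^sup>2) = (x - y) * ((1 + t\<^sup>2) * (x + y) + k)" for x y
    unfolding k_def by algebra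
  have "(1 + t\<^sup>2) * (xc A + xc B) + k = 0" "(1 + t\<^sup>2) * (xc B + xc C) + k = 0"
    using q diff[of "xc A" "xc B"] diff[of "xc B" "xc C"] ne unfolding * by simp_all
  then have "(1 + t\<^sup>2) * (xc A - xc C) = 0" by algebra
  moreover have "1 + t\<^sup>2 > 0" by (simp add: add_pos_nonneg)
  ultimately show False using ne by auto
qed

text \<open>Hypotheses \<open>s\<close> and \<open>t\<close> are Vieta relations on the two tangents
  through the vertex. Subtracting them and dividing by \<open>s - t\<close> gives \<open>n\<close>,
  then \<open>m\<close>, hence the equations of a tangent triple. Both kinds of triangle use this,
  the trivial one with \<open>u = s\<close>.\<close>

lemma focus_on_circ:
  assumes st: "s \<noteq> t" and X: "pt (s + t) (s * t) \<in> circ m n \<rho>"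
    and s: "(t + u) * (1 + s\<^sup>2) + 2 * s = 2 * m + 2 * n * s"
    and t: "(s + u) * (1 + t\<^sup>2) + 2 * t = 2 * m + 2 * n * t"
  shows "pt 0 1 \<in> circ m n \<rho>"
proof -
  have "(s - t) * (1 + s * t + s * u + t * u - 2 * n) = 0" using s t by algebra
  then have n: "2 * n = 1 + s * t + s * u + t * u" using st by simp
  have m: "2 * m = s + t + u - s * t * u" using s n by algebra
  have "(s + t - m)\<^sup>2 + (s * t - n)\<^sup>2 = \<rho>" using X by simp
  moreover have "(s + t - m)\<^sup>2 + (s * t - n)\<^sup>2 - (m\<^sup>2 + (1 - n)\<^sup>2) = (s + t) * (s + t - 2 * m) + s * t * (s * t - 2 * n) + 2 * n - 1" by algebra
  moreover have "\<dots> = 0" unfolding m n by algebra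
  ultimately show ?thesis by simp
qed

text \<open>The equation is Vieta's formula for the two parameters at which the tangent with parameter
  \<open>s\<close> meets the circle.\<close>

lemma chord_sum:
  assumes "pt (s + t) (s * t) \<in> circ m n \<rho>" "pt (s + u) (s * u) \<in> circ m n \<rho>" "t \<noteq> u"
  shows "(t + u) * (1 + s\<^sup>2) + 2 * s = 2 * m + 2 * n * s"
proof -
  have "(s + t - m)\<^sup>2 + (s * t - n)\<^sup>2 = \<rho>" "(s + u - m)\<^sup>2 + (s * u - n)\<^sup>2 = \<rho>" using assms by auto
  moreover have "(s + t - m)\<^sup>2 + (s * t - n)\<^sup>2 - ((s + u - m)\<^sup>2 + (s * u - n)\<^sup>2)
    = (t - u) * ((t + u) * (1 + s\<^sup>2) + 2 * s - (2 * m + 2 * n * s))" by algebra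
  ultimately have "(t - u) * ((t + u) * (1 + s\<^sup>2) + 2 * s - (2 * m + 2 * n * s)) = 0" by simp
  then show ?thesis using \<open>t \<noteq> u\<close> by simp
qed

lemma nontrivial_imp_focus:
  assumes "nontrivial_triangle (circ m n \<rho>) par A B C"
  shows "pt 0 1 \<in> circ m n \<rho>"
proof -
  from assms have D: "A \<in> circ m n \<rho>" "B \<in> circ m n \<rho>" "C \<in> circ m n \<rho>" and ne: "A \<noteq> B" "B \<noteq> C" "A \<noteq> C"
    unfolding nontrivial_triangle_def by blast+
  from assms obtain s t u where h: "affine hull {A, B} = tline s" "affine hull {B, C} = tline t" "affine hull {A, C} = tline u"
    unfolding nontrivial_triangle_def tangent_line_par by blast
  then have l: "A \<in> tline s" "B \<in> tline s" "B \<in> tline t" "C \<in> tline t" "A \<in> tline u" "C \<in> tline u"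
    unfolding h[symmetric] by (simp_all add: hull_inc)
  \<comment> \<open>Two sides on one tangent would put all three vertices on it.\<close>
  have dist: "s \<noteq> t" "s \<noteq> u" "t \<noteq> u"
    using tline_circ_at_most_two[OF _ _ _ D ne] l by blast+
  have "A = pt (s + u) (s * u)" "B = pt (s + t) (s * t)" "C = pt (t + u) (t * u)"
    using tline_inter dist l by blast+
  then have "pt (s + u) (s * u) \<in> circ m n \<rho>" "pt (s + t) (s * t) \<in> circ m n \<rho>" "pt (t + u) (t * u) \<in> circ m n \<rho>"
    using D by simp_all
  then show ?thesis
    using dist by (intro focus_on_circ[of s t _ _ _ u] chord_sum) (simp_all add: add.commute mult.commute)
qed

text \<open>With \<open>a\<close> the tangent at \<open>Y\<close> and \<open>b\<close> the common
  tangent, the chord on \<open>a\<close> gives one Vieta relation, and tangency at \<open>X\<close>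
  gives the other with a double root.\<close>

lemma trivial_imp_focus:
  assumes \<rho>: "\<rho> > 0" and tri: "trivial_triangle (circ m n \<rho>) par Y X"
  shows "pt 0 1 \<in> circ m n \<rho>"
proof -
  have YD: "Y \<in> circ m n \<rho>" and XD: "X \<in> circ m n \<rho>" and ne: "X \<noteq> Y"
    using tri unfolding trivial_triangle_def by blast+
  obtain k where "tangent_line_at par Y k" "X \<in> k"
    using tri unfolding trivial_triangle_def by blast
  then obtain a where Y: "Y = pt (2 * a) (a\<^sup>2)" and Xa: "X \<in> tline a"
    unfolding tangent_line_at_par by blast
  obtain l where l0: "tangent_line_at (circ m n \<rho>) X l" "tangent_line par l"
    using tri unfolding trivial_triangle_def common_tangent_point_def by blast
  then obtain b where l: "tangent_line_at (circ m n \<rho>) X l" "l = tline b"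
    unfolding tangent_line_par by blast
  have lX: "tline b = {Z. (xc X - m) * (xc Z - xc X) + (yc X - n) * (yc Z - yc X) = 0}"
    using l(1) unfolding l(2) tangent_line_at_circ[OF \<rho>] by (rule conjunct2)
  then have Xb: "X \<in> tline b" by simp
  \<comment> \<open>Otherwise \<open>Y\<close> would be a second point of the circle on its tangent
    at \<open>X\<close>.\<close>
  have "a \<noteq> b"
  proof
    assume "a = b"
    have "Y \<in> tline a" by (simp add: Y tline_def power2_eq_square)
    then have "(xc X - m) * (xc Y - xc X) + (yc X - n) * (yc Y - yc X) = 0" using lX \<open>a = b\<close> by simp
    moreover have "(xc X - m)\<^sup>2 + (yc X - n)\<^sup>2 = \<rho>" "(xc Y - m)\<^sup>2 + (yc Y - n)\<^sup>2 = \<rho>" using XD YD by auto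
    moreover have "(xc Y - m)\<^sup>2 + (yc Y - n)\<^sup>2 = (xc X - m)\<^sup>2 + (yc X - n)\<^sup>2
      + 2 * ((xc X - m) * (xc Y - xc X) + (yc X - n) * (yc Y - yc X)) + ((xc Y - xc X)\<^sup>2 + (yc Y - yc X)\<^sup>2)"
      by algebra
    ultimately have "(xc Y - xc X)\<^sup>2 + (yc Y - yc X)\<^sup>2 = 0" by simp
    then show False using ne by (simp add: point_eq_iff sum_power2_eq_zero_iff)
  qed
  then have X: "X = pt (a + b) (a * b)" using tline_inter[of a b X] Xa Xb by blast
  \<comment> \<open>A second point of the tangent, displaced from \<open>X\<close> by
    \<open>(1, b)\<close>, extracts the orthogonality of radius and tangent.\<close>
  have "pt (a + b + 1) (a * b + b) \<in> tline b" by (simp add: tline_def power2_eq_square algebra_simps)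
  then have "(a + b - m) + (a * b - n) * b = 0" unfolding lX X by simp
  then have "(a + a) * (1 + b\<^sup>2) + 2 * b = 2 * m + 2 * n * b" by algebra
  moreover have "(a + b) * (1 + a\<^sup>2) + 2 * a = 2 * m + 2 * n * a"
    using YD XD \<open>a \<noteq> b\<close> unfolding X Y by (intro chord_sum[of _ _ _ _ \<rho>]) (simp_all add: power2_eq_square)
  ultimately show ?thesis
    using \<open>a \<noteq> b\<close> XD unfolding X by (intro focus_on_circ[of a b _ _ _ a]) (simp_all add: add.commute)
qed

text \<open>The parameters are the roots of \<open>z\<^sup>2 - xc X * z + yc X\<close>; the weak
  inequality admits points of the parabola, as a double root.\<close>

lemma exterior_point:
  assumes "(xc X)\<^sup>2 \<ge> 4 * yc X"
  obtains s t where "X = pt (s + t) (s * t)"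
proof (rule that)
  let ?q = "sqrt ((xc X)\<^sup>2 - 4 * yc X)"
  have "?q\<^sup>2 = (xc X)\<^sup>2 - 4 * yc X" using assms by simp
  then show "X = pt ((xc X + ?q) / 2 + (xc X - ?q) / 2) ((xc X + ?q) / 2 * ((xc X - ?q) / 2))"
    by (simp add: point_eq_iff field_simps power2_eq_square)
qed

end

section \<open>Choice of the frame and assembly of the theorem\<close>

lemma parabola_frame_exists:
  assumes "is_line d" "F \<notin> d"
  obtains p e where "parabola_frame e" "F = parabola_frame.pt p e 0 1" "d = {X. parabola_frame.yc p e X = -1}"
proof -
  from assms have "affine d" "aff_dim d = 1" by (auto simp: is_line_def)
  obtain B where B: "affine hull B = affine hull d" "int (card B) = aff_dim d + 1"
    using aff_dim_basis_exists by blast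
  then have "card B = 2" using \<open>aff_dim d = 1\<close> by simp
  then obtain a b where ab: "B = {a, b}" "a \<noteq> b" by (auto simp: card_2_iff)
  have "d = affine hull {a, b}" using B(1) \<open>affine d\<close> unfolding ab by (metis affine_hull_eq)
  then have d: "d = range (\<lambda>s. a + s *\<^sub>R (b - a))" by (auto simp: affine_hull_2_alt)
  define w where "w = b - a"
  \<comment> \<open>\<open>a + k *\<^sub>R w\<close> is the foot of the perpendicular from
    \<open>F\<close> to \<open>d\<close>.\<close>
  define k where "k = (F - a) \<bullet> w / (w \<bullet> w)"
  \<comment> \<open>Half of the perpendicular, so that the vertex \<open>F - e\<close> is its
    midpoint and the directrix has height -1.\<close>
  define e where "e = (1/2) *\<^sub>R (F - (a + k *\<^sub>R w))"
  have w: "w \<noteq> 0" using ab by (simp add: w_def)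
  have ew: "w \<bullet> e = 0" using w by (simp add: e_def k_def inner_diff_right inner_add_right inner_commute)
  have e0: "e \<noteq> 0" using assms(2) unfolding e_def d by (auto simp: w_def)
  interpret parabola_frame "F - e" e by unfold_locales (rule e0)
  have "pt 0 1 = F" by (simp add: pt_def)
  moreover have "d = {X. yc X = -1}"
  proof -
    have "d = {X. 0 * (xc X - xc a) + 1 * (yc X - yc a) = 0}"
      unfolding d w_def[symmetric] using w ew by (intro line_eq_level_set) (auto simp: yd_def)
    moreover have "yc a = -1"
    proof -
      have "a = (F - e) + (-1) *\<^sub>R e + (-k) *\<^sub>R w" by (simp add: e_def algebra_simps flip: scaleR_add_left)
      then have "yc a = yc (F - e) + (-1) * yd e + (-k) * yd w" by (metis coords_add_scaled(2))
      then show ?thesis using ew e0 by (simp add: yc_def yd_def)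
    qed
    ultimately show ?thesis by (auto simp: add_eq_0_iff2)
  qed
  ultimately show ?thesis using that[of e "F - e"] parabola_frame_axioms by simp
qed

theorem theorem3p1:
  fixes c F :: "real^2" and r :: real and d D P :: "(real^2) set"
  assumes "r > 0" and "D = sphere c r"
    and "is_line d" and "F \<notin> d" and "P = parabola F d"
    and "nowhere_tangential D P"
    and "D \<inter> nonconvex_complement P \<noteq> {}"
  shows "((\<exists>V. poncelet_triangle D P V) \<longleftrightarrow> F \<in> D) \<and>
    (F \<in> D \<longrightarrow>
      (\<forall>X \<in> (D \<inter> nonconvex_complement P) \<union> (D \<inter> P).
         \<exists>V. poncelet_triangle D P V \<and> X \<in> V))"
proof -
  obtain p e where pe: "parabola_frame e" "F = parabola_frame.pt p e 0 1" "d = {X. parabola_frame.yc p e X = -1}"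
    using parabola_frame_exists[OF assms(3,4)] .
  interpret parabola_frame p e by (rule pe(1))
  define \<rho> where "\<rho> = r\<^sup>2 / (e \<bullet> e)"
  have \<rho>: "\<rho> > 0" using assms(1) ee_pos by (simp add: \<rho>_def)
  have D: "D = circ (xc c) (yc c) \<rho>" using sphere_eq_circ[OF assms(1)] assms(2) by (simp add: \<rho>_def)
  have P: "P = par" using assms(5) pe parabola_eq_par by simp
  have vertex: "\<exists>V. poncelet_triangle D P V \<and> X \<in> V"
    if F: "F \<in> D" and X: "X \<in> (D \<inter> nonconvex_complement P) \<union> (D \<inter> P)" for X
  proof -
    have "(xc X)\<^sup>2 \<ge> 4 * yc X"
      using X nonconvex_complement_par[of X] unfolding P by auto
    then obtain s t where st: "X = pt (s + t) (s * t)" by (rule exterior_point)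
    show ?thesis
      using poncelet_triangle_through[OF \<rho>, of "xc c" "yc c" s t] F X assms(6)
      unfolding st D P pe(2) by blast
  qed
  moreover have "F \<in> D" if "poncelet_triangle D P V" for V
    using that nontrivial_imp_focus trivial_imp_focus[OF \<rho>]
    unfolding poncelet_triangle_def D P pe(2) by blast
  \<comment> \<open>The nonempty intersection supplies a point for \<open>vertex\<close>, which
    gives existence once the focus is on the circle.\<close>
  ultimately show ?thesis using assms(7) by blast
qed

end
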